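(* Let $r$ be a positive integer, let $s_1,\dots,s_r$ be complex numbers whose real parts $\sigma_1,\dots,\sigma_r$ satisfy $\sigma_1\le\sigma_2\le\cdots\le\sigma_r$, and let $s$ be a complex number with real part $\sigma$. If $\sigma+\sum_{j=1}^k\sigma_j>k$ for each integer $k$ with $1\le k\le r$, then the series \[ T(s_1,\dots,s_r;s)=\sum_{m_1=1}^\infty\cdots\sum_{m_r=1}^\infty \frac{1}{m_1^{s_1}\cdots m_r^{s_r}(m_1+\cdots+m_r)^{s}} \] is absolutely convergent. *)

theory Defs
  imports "HOL-Analysis.Analysis"
begin

definition tornheim_term :: "nat \<Rightarrow> (nat \<Rightarrow> complex) \<Rightarrow> complex \<Rightarrow> (nat \<Rightarrow> nat) \<Rightarrow> complex" where
  "tornheim_term r s t m =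
     1 / ((\<Prod>j=1..r. of_nat (m j) powr s j) * of_nat (\<Sum>j=1..r. m j) powr t)"

text \<open>
  The \<open>r\<close>-tuples of positive integers are represented by the extensional functions on \<open>{1..r}\<close>,
  so that each tuple occurs exactly once in the index set.
\<close>

definition pos_tuples :: "nat \<Rightarrow> (nat \<Rightarrow> nat) set" where
  "pos_tuples r = {1..r} \<rightarrow>\<^sub>E {1..}"

end

theory Submission
  imports Defs
begin

text \<open>
  Write \<open>\<sigma>\<close> for the real part of \<open>s\<close>. If \<open>\<sigma> > 0\<close>, monotonicity of the \<open>\<sigma>\<^sub>j\<close> gives
  \<open>(\<Sum>j. max 0 (1 - \<sigma>\<^sub>j)) < \<sigma>\<close>, so \<open>\<sigma>\<close> splits as \<open>\<Sum>j. c\<^sub>j\<close> with \<open>c\<^sub>j \<ge> 0\<close> and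
  \<open>\<sigma>\<^sub>j + c\<^sub>j > 1\<close>; bounding \<open>(m\<^sub>1 + \<dots> + m\<^sub>r) powr - c\<^sub>j\<close> by \<open>m\<^sub>j powr - c\<^sub>j\<close> reduces the series to a
  product of convergent zeta series. If \<open>\<sigma> \<le> 0\<close>, the case \<open>k = 1\<close> gives \<open>\<sigma>\<^sub>j \<ge> \<sigma>\<^sub>1 > 1 - \<sigma>\<close> for
  all \<open>j\<close>, and \<open>(m\<^sub>1 + \<dots> + m\<^sub>r) powr - \<sigma>\<close> is at most a constant times \<open>\<Sum>i. m\<^sub>i powr - \<sigma>\<close>, so the
  series is dominated by \<open>r\<close> such products.
\<close>

text \<open>For nonnegative terms, summability and absolute summability coincide, so this reduces to
  the product theorem \<open>abs_summable_on_prod_PiE\<close> for absolute summability.\<close>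

lemma summable_on_prod_PiE:
  fixes f :: "'a \<Rightarrow> 'b \<Rightarrow> real"
  assumes "finite A" "\<And>x. x \<in> A \<Longrightarrow> countable (B x)"
    and "\<And>x y. x \<in> A \<Longrightarrow> y \<in> B x \<Longrightarrow> f x y \<ge> 0"
    and "\<And>x. x \<in> A \<Longrightarrow> f x summable_on B x"
  shows "(\<lambda>g. \<Prod>x\<in>A. f x (g x)) summable_on PiE A B"
proof -
  have "Infinite_Set_Sum.abs_summable_on (f x) (B x)" if "x \<in> A" for x
    using assms(3,4)[OF that] summable_on_cong[of "B x" "\<lambda>y. norm (f x y)" "f x"]
    by (simp flip: abs_summable_equivalent)
  then have "Infinite_Set_Sum.abs_summable_on (\<lambda>g. \<Prod>x\<in>A. f x (g x)) (PiE A B)"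
    by (intro abs_summable_on_prod_PiE assms)
  then show ?thesis
    by (simp add: abs_summable_summable flip: abs_summable_equivalent)
qed

text \<open>The series over tuples factors into the zeta series at \<open>b j\<close>, each
  convergent since \<open>b j > 1\<close>.\<close>

lemma summable_on_prod_powr_pos_tuples:
  assumes "\<And>j. j \<in> {1..r} \<Longrightarrow> b j > 1"
  shows "(\<lambda>m. \<Prod>j=1..r. real (m j) powr - b j) summable_on pos_tuples r"
  unfolding pos_tuples_def
proof (rule summable_on_prod_PiE)
  fix j assume "j \<in> {1..r}"
  then have "summable (\<lambda>n. real n powr - b j)"
    using assms by (simp add: summable_real_powr_iff)
  then have "(\<lambda>n. real n powr - b j) summable_on UNIV"
    by (simp add: summable_on_UNIV_nonneg_real_iff)
  then show "(\<lambda>n. real n powr - b j) summable_on {1..}"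
    by (rule summable_on_subset_banach) simp
qed auto

lemma norm_tornheim_term:
  "norm (tornheim_term r s t m) =
     (\<Prod>j=1..r. real (m j) powr - Re (s j)) * real (\<Sum>j=1..r. m j) powr - Re t"
proof -
  \<comment> \<open>At \<open>n = 0\<close> both sides are 0, by the convention
    \<open>0 powr z = 0\<close>.\<close>
  have norm_of_nat_powr: "norm (of_nat n powr z :: complex) = real n powr Re z" for n z
    by (simp add: norm_powr_real_powr)
  show ?thesis
    unfolding tornheim_term_def norm_divide norm_mult prod_norm [symmetric] norm_of_nat_powr
    by (simp add: powr_minus divide_inverse prod_inversef [unfolded o_def])
qed

text \<open>Induction on prefixes. If the newest \<open>a (Suc n)\<close> is at least 1, its deficit
  is 0 and the sum does not change. Otherwise monotonicity puts every earlier value below 1 too, so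
  no truncation at 0 occurs and the claim is exactly \<open>bound\<close> at
  \<open>Suc n\<close>.\<close>

lemma sum_deficit_less:
  fixes a :: "nat \<Rightarrow> real"
  assumes mono: "\<And>i j. i \<in> {1..r} \<Longrightarrow> j \<in> {1..r} \<Longrightarrow> i \<le> j \<Longrightarrow> a i \<le> a j"
    and bound: "\<And>k. k \<in> {1..r} \<Longrightarrow> c + (\<Sum>j=1..k. a j) > real k"
    and "c > 0"
  shows "(\<Sum>j=1..r. max 0 (1 - a j)) < c"
proof -
  have "(\<Sum>j=1..n. max 0 (1 - a j)) < c" if "n \<le> r" for n
    using that
  proof (induction n)
    case 0
    then show ?case using \<open>c > 0\<close> by simp
  next
    case (Suc n)
    show ?case
    proof (cases "a (Suc n) \<ge> 1")
      case True
      then show ?thesis using Suc by simp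
    next
      case False
      have "max 0 (1 - a j) = 1 - a j" if "j \<in> {1..Suc n}" for j
        using mono[of j "Suc n"] that Suc.prems False by simp
      then have "(\<Sum>j=1..Suc n. max 0 (1 - a j)) = (\<Sum>j=1..Suc n. 1 - a j)"
        by (rule sum.cong[OF refl])
      also have "\<dots> = real (Suc n) - (\<Sum>j=1..Suc n. a j)"
        by (subst sum_subtractf) simp
      also have "\<dots> < c"
        using bound[of "Suc n"] Suc.prems by simp
      finally show ?thesis .
    qed
  qed
  then show ?thesis by simp
qed

lemma summable_on_tornheim_pos:
  fixes a :: "nat \<Rightarrow> real"
  assumes "r \<ge> 1" and less: "(\<Sum>j=1..r. max 0 (1 - a j)) < c"
  shows "(\<lambda>m. (\<Prod>j=1..r. real (m j) powr - a j) * real (\<Sum>j=1..r. m j) powr - c)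
           summable_on pos_tuples r"
proof -
  \<comment> \<open>The slack in \<open>less\<close> is shared equally among the \<open>r\<close>
    indices: the \<open>d j\<close> then add up to \<open>c\<close>, while \<open>a j + d j\<close>
    is at least \<open>1 + \<delta>\<close>.\<close>
  define \<delta> where "\<delta> = (c - (\<Sum>j=1..r. max 0 (1 - a j))) / real r"
  define d where "d j = max 0 (1 - a j) + \<delta>" for j
  have "\<delta> > 0" using assms by (simp add: \<delta>_def)
  have sum_d: "(\<Sum>j=1..r. d j) = c"
    using \<open>r \<ge> 1\<close> by (simp add: d_def \<delta>_def sum.distrib)
  show ?thesis
  proof (rule summable_on_comparison_test)
    show "(\<lambda>m. \<Prod>j=1..r. real (m j) powr - (a j + d j)) summable_on pos_tuples r"
      using \<open>\<delta> > 0\<close> by (intro summable_on_prod_powr_pos_tuples) (simp add: d_def)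
  next
    fix m assume "m \<in> pos_tuples r"
    then have pos: "m j \<ge> 1" if "j \<in> {1..r}" for j
      using that by (auto simp: pos_tuples_def PiE_iff)
    have le: "m j \<le> (\<Sum>j=1..r. m j)" if "j \<in> {1..r}" for j
      by (rule member_le_sum) (use that in auto)
    \<comment> \<open>\<open>powr_sum\<close> turns a sum of exponents into a product only for a
      nonzero base.\<close>
    have "real (\<Sum>j=1..r. m j) \<noteq> 0"
      using le[of 1] pos[of 1] \<open>r \<ge> 1\<close> by (simp del: of_nat_sum sum_eq_0_iff)
    then have "real (\<Sum>j=1..r. m j) powr - c = (\<Prod>j=1..r. real (\<Sum>j=1..r. m j) powr - d j)"
      by (simp add: powr_sum flip: sum_d sum_negf)
    also have "\<dots> \<le> (\<Prod>j=1..r. real (m j) powr - d j)"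
    proof (rule prod_mono, intro conjI)
      fix j assume j: "j \<in> {1..r}"
      have "d j \<ge> 0" using \<open>\<delta> > 0\<close> by (simp add: d_def)
      then show "real (\<Sum>j=1..r. m j) powr - d j \<le> real (m j) powr - d j"
        using pos[OF j] le[OF j] by (intro powr_mono2') (simp_all del: of_nat_sum)
    qed simp
    finally have "(\<Prod>j=1..r. real (m j) powr - a j) * real (\<Sum>j=1..r. m j) powr - c
        \<le> (\<Prod>j=1..r. real (m j) powr - a j) * (\<Prod>j=1..r. real (m j) powr - d j)"
      by (intro mult_left_mono prod_nonneg) auto
    also have "\<dots> = (\<Prod>j=1..r. real (m j) powr - (a j + d j))"
      by (simp add: powr_add powr_minus del: minus_add_distrib flip: prod.distrib)
    finally show "(\<Prod>j=1..r. real (m j) powr - a j) * real (\<Sum>j=1..r. m j) powr - c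
        \<le> (\<Prod>j=1..r. real (m j) powr - (a j + d j))" .
  qed (auto intro!: mult_nonneg_nonneg prod_nonneg)
qed

lemma summable_on_finite_sum:
  fixes f :: "'i \<Rightarrow> 'a \<Rightarrow> 'b :: {topological_comm_monoid_add}"
  assumes "\<And>i. i \<in> I \<Longrightarrow> f i summable_on A"
  shows "(\<lambda>x. \<Sum>i\<in>I. f i x) summable_on A"
  using assms by (induction I rule: infinite_finite_induct) (auto intro: summable_on_add)

text \<open>The sum is at most \<open>card I\<close> times its largest entry, and the
  \<open>p\<close>-th power of that entry is one of the summands on the right. The constant is
  crude, but the argument makes no use of convexity and so covers p < 1 as well.\<close>

lemma powr_sum_le_card_powr_sum:
  fixes x :: "'a \<Rightarrow> real"
  assumes "finite I" "\<And>i. i \<in> I \<Longrightarrow> x i \<ge> 0" "p \<ge> 0"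
  shows "(\<Sum>i\<in>I. x i) powr p \<le> real (card I) powr p * (\<Sum>i\<in>I. x i powr p)"
proof (cases "I = {}")
  case False
  define M where "M = Max (x ` I)"
  obtain i where i: "i \<in> I" "x i = M"
    using Max_in[of "x ` I"] assms(1) False by (metis M_def finite_imageI image_iff image_is_empty)
  have "(\<Sum>i\<in>I. x i) \<le> real (card I) * M"
    using assms(1) by (intro sum_bounded_above) (auto simp: M_def)
  then have "(\<Sum>i\<in>I. x i) powr p \<le> (real (card I) * M) powr p"
    using assms by (intro powr_mono2 sum_nonneg) auto
  also have "\<dots> = real (card I) powr p * x i powr p"
    using assms(2) i by (metis of_nat_0_le_iff powr_mult)
  also have "\<dots> \<le> real (card I) powr p * (\<Sum>i\<in>I. x i powr p)"
    using assms(1) i(1) by (intro mult_left_mono member_le_sum) auto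
  finally show ?thesis .
qed simp

lemma summable_on_tornheim_nonpos:
  fixes a :: "nat \<Rightarrow> real"
  assumes "c \<le> 0" and greater: "\<And>j. j \<in> {1..r} \<Longrightarrow> a j > 1 - c"
  shows "(\<lambda>m. (\<Prod>j=1..r. real (m j) powr - a j) * real (\<Sum>j=1..r. m j) powr - c)
           summable_on pos_tuples r"
proof (rule summable_on_comparison_test)
  \<comment> \<open>The \<open>i\<close>-th summand of the bound on the power of the total is
    absorbed into the \<open>i\<close>-th factor. That exponent drops to \<open>a i + c\<close>,
    still above 1 by \<open>greater\<close>; the others exceed \<open>1 - c\<close>, hence
    1.\<close>
  define b where "b i j = (if j = i then a j + c else a j)" for i j
  let ?F = "\<lambda>m. real r powr - c * (\<Sum>i=1..r. \<Prod>j=1..r. real (m j) powr - b i j)"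
  have "b i j > 1" if "j \<in> {1..r}" for i j
    using greater[OF that] \<open>c \<le> 0\<close> by (auto simp: b_def)
  then show "?F summable_on pos_tuples r"
    by (intro summable_on_cmult_right summable_on_finite_sum summable_on_prod_powr_pos_tuples)
  fix m :: "nat \<Rightarrow> nat"
  have prod_b: "(\<Prod>j=1..r. real (m j) powr - a j) * real (m i) powr - c =
      (\<Prod>j=1..r. real (m j) powr - b i j)" if i: "i \<in> {1..r}" for i
  proof -
    \<comment> \<open>The extra power of \<open>m i\<close> is written as a product of factors equal
      to 1 away from \<open>i\<close>. A zero entry is no exception, since
      \<open>0 powr x = 0\<close> for every \<open>x\<close>.\<close>
    have "(\<Prod>j=1..r. real (m j) powr - b i j) =
        (\<Prod>j=1..r. real (m j) powr - a j * (if j = i then real (m j) powr - c else 1))"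
      by (intro prod.cong) (auto simp: b_def powr_add powr_minus)
    also have "\<dots> = (\<Prod>j=1..r. real (m j) powr - a j) * real (m i) powr - c"
      using i by (subst prod.distrib) (simp add: prod.delta)
    finally show ?thesis by simp
  qed
  have "real (\<Sum>j=1..r. m j) powr - c \<le> real r powr - c * (\<Sum>i=1..r. real (m i) powr - c)"
    using powr_sum_le_card_powr_sum[of "{1..r}" "\<lambda>i. real (m i)" "- c"] \<open>c \<le> 0\<close> by simp
  then have "(\<Prod>j=1..r. real (m j) powr - a j) * real (\<Sum>j=1..r. m j) powr - c
      \<le> (\<Prod>j=1..r. real (m j) powr - a j) * (real r powr - c * (\<Sum>i=1..r. real (m i) powr - c))"
    by (intro mult_left_mono prod_nonneg) auto
  also have "\<dots> = real r powr - c *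
      (\<Sum>i=1..r. (\<Prod>j=1..r. real (m j) powr - a j) * real (m i) powr - c)"
    by (simp only: sum_distrib_left mult.left_commute)
  also have "\<dots> = ?F m"
    by (simp only: prod_b cong: sum.cong)
  finally show "(\<Prod>j=1..r. real (m j) powr - a j) * real (\<Sum>j=1..r. m j) powr - c \<le> ?F m" .
qed (auto intro!: mult_nonneg_nonneg prod_nonneg)

theorem theorem2p2:
  fixes r :: nat and s :: "nat \<Rightarrow> complex" and t :: complex
  assumes "r \<ge> 1"
    and "\<forall>i\<in>{1..r}. \<forall>j\<in>{1..r}. i \<le> j \<longrightarrow> Re (s i) \<le> Re (s j)"
    and "\<forall>k\<in>{1..r}. Re t + (\<Sum>j=1..k. Re (s j)) > real k"
  shows "(\<lambda>m. norm (tornheim_term r s t m)) summable_on pos_tuples r"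
proof (cases "Re t > 0")
  case True
  then show ?thesis
    unfolding norm_tornheim_term
    using assms by (intro summable_on_tornheim_pos sum_deficit_less) auto
next
  case False
  have "Re t + Re (s 1) > 1"
    using assms(1) bspec[OF assms(3), of 1] by simp
  moreover have "Re (s 1) \<le> Re (s j)" if "j \<in> {1..r}" for j
    using assms(1,2) that by simp
  ultimately have "Re (s j) > 1 - Re t" if "j \<in> {1..r}" for j
    using that by fastforce
  with False show ?thesis
    unfolding norm_tornheim_term by (intro summable_on_tornheim_nonpos) auto
qed

end
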